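(* Let $(\mathcal A,I)$ and $(\mathcal B,J)$ be hypergraphs that both satisfy the weak intersection property, and let $\iota:\mathcal A\to\mathcal B$ be an inclusion of posets that is a strict and simplicial morphism. If $\overline F'$ is a restricted free copresheaf over $\mathcal B$ (over a commutative field $\mathbb K$), then the inverse image $\overline F=\iota^*\overline F'$ over $\mathcal A$ is a restricted free copresheaf, there is a natural surjection from $\overline F'$ to $\iota_*\overline F$, and the induced natural map in cohomology $\iota^*:H^0(\mathcal B;\overline F')\to H^0(\mathcal A;\overline F)$ is surjective.
   Context: Hypergraph: $I$ is a set and $\mathcal A$ is a set of finite subsets of $I$, viewed as a poset category with an arrow $\alpha\to\beta$ iff $\beta\subseteq\alpha$ (similarly $\mathcal B$ is a set of finite subsets of $J$). Weak intersection property: $\alpha\cap\alpha'\in\mathcal A$ for all $\alpha,\alpha'\in\mathcal A$ with $\alpha\cap\alpha'\ne\emptyset$. Strict morphism $(\mathcal A,I)\to(\mathcal B,J)$: a pair of an increasing map (functor) $f:\mathcal A\to\mathcal B$ and a map $f_I:I\to J$ with $f_I(i)\in f(\alpha)$ whenever $i\in\alpha\in\mathcal A$. It is simplicial if moreover $f_I$ maps $\alpha$ onto $f(\alpha)$ for every $\alpha\in\mathcal A$. For an inclusion, both $\iota$ and the underlying map $\iota_I:I\to J$ are injective. Restricted free copresheaf over $\mathcal B$: given non-empty sets $E'_j$, $j\in J$, put $E'_\beta=\prod_{j\in\beta}E'_j$ with coordinate projections $E'_\beta\to E'_{\gamma}$ for $\gamma\subseteq\beta$; $\overline F'_\beta$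 is the subspace of $\mathbb K^{(E'_\beta)}$ (vector space with basis $E'_\beta$) of vectors whose coordinates sum to zero, with the maps induced by the projections; this is a covariant functor on $\mathcal B$. Likewise over $\mathcal A$, with sets $E_i$, $i\in I$. Topology: $X_{\mathcal A}$ is the set $\mathcal A$ with the lower Alexandrov topology, with basis $U_\alpha=\{\beta\in\mathcal A\mid\alpha\to\beta\}$; covariant functors $G$ on $\mathcal A$ are identified with sheaves on $X_{\mathcal A}$ via $G(W)=\varprojlim_{\omega\in W}G_\omega$ for $W$ open; likewise for $\mathcal B$. Increasing maps are continuous; $(\iota^*\overline F')_\alpha=\overline F'_{\iota(\alpha)}$ and $(\iota_*\overline F)_\beta=\overline F(\iota^{-1}(U_\beta))$. $H^0(\mathcal A;-)$ is Čech cohomology of $X_{\mathcal A}$ in degree $0$, i.e. the space of global sections $\varprojlim_{\mathcal A}$, and likewise for $\mathcal B$. *)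

theory Defs
  imports Complex_Main "HOL-Library.Poly_Mapping" "HOL-Library.Function_Algebras" "HOL-Library.FuncSet"
begin

section \<open>Hypergraphs and their morphisms\<close>

definition hypergraph :: "'i set set \<Rightarrow> 'i set \<Rightarrow> bool" where
  "hypergraph A I \<longleftrightarrow> (\<forall>\<alpha>\<in>A. finite \<alpha> \<and> \<alpha> \<subseteq> I)"

definition weak_intersection_property :: "'i set set \<Rightarrow> bool" where
  "weak_intersection_property A \<longleftrightarrow>
     (\<forall>\<alpha>\<in>A. \<forall>\<alpha>'\<in>A. \<alpha> \<inter> \<alpha>' \<noteq> {} \<longrightarrow> \<alpha> \<inter> \<alpha>' \<in> A)"

definition strict_morphism ::
  "'i set set \<Rightarrow> 'i set \<Rightarrow> 'j set set \<Rightarrow> 'j set \<Rightarrow> ('i set \<Rightarrow> 'j set) \<Rightarrow> ('i \<Rightarrow> 'j) \<Rightarrow> bool" where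
  "strict_morphism A I B J f f\<^sub>I \<longleftrightarrow>
     f \<in> A \<rightarrow> B \<and> f\<^sub>I \<in> I \<rightarrow> J \<and>
     (\<forall>\<alpha>\<in>A. \<forall>\<beta>\<in>A. \<beta> \<subseteq> \<alpha> \<longrightarrow> f \<beta> \<subseteq> f \<alpha>) \<and>
     (\<forall>\<alpha>\<in>A. \<forall>i\<in>\<alpha>. f\<^sub>I i \<in> f \<alpha>)"

definition simplicial_morphism ::
  "'i set set \<Rightarrow> 'i set \<Rightarrow> 'j set set \<Rightarrow> 'j set \<Rightarrow> ('i set \<Rightarrow> 'j set) \<Rightarrow> ('i \<Rightarrow> 'j) \<Rightarrow> bool" where
  "simplicial_morphism A I B J f f\<^sub>I \<longleftrightarrow>
     strict_morphism A I B J f f\<^sub>I \<and> (\<forall>\<alpha>\<in>A. f\<^sub>I ` \<alpha> = f \<alpha>)"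

definition simplicial_inclusion ::
  "'i set set \<Rightarrow> 'i set \<Rightarrow> 'j set set \<Rightarrow> 'j set \<Rightarrow> ('i set \<Rightarrow> 'j set) \<Rightarrow> ('i \<Rightarrow> 'j) \<Rightarrow> bool" where
  "simplicial_inclusion A I B J f f\<^sub>I \<longleftrightarrow>
     simplicial_morphism A I B J f f\<^sub>I \<and> inj_on f A \<and> inj_on f\<^sub>I I"


section \<open>Copresheaves of vector spaces\<close>

text \<open>
  A hypergraph is a category with an arrow from \<open>\<alpha>\<close> to \<open>\<beta>\<close> exactly when \<open>\<beta> \<subseteq> \<alpha>\<close>.  A
  covariant functor to vector spaces is given by subspaces \<open>obj F \<alpha>\<close> of one ambient vector
  space and maps \<open>res F \<alpha> \<beta>\<close>, which are meaningful only for \<open>\<beta> \<subseteq> \<alpha>\<close> and on \<open>obj F \<alpha>\<close>.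
\<close>

record ('i, 'v) functor_data =
  obj :: "'i set \<Rightarrow> 'v set"
  res :: "'i set \<Rightarrow> 'i set \<Rightarrow> 'v \<Rightarrow> 'v"

definition linear_between ::
  "('k \<Rightarrow> 'v \<Rightarrow> 'v) \<Rightarrow> ('k \<Rightarrow> 'w \<Rightarrow> 'w) \<Rightarrow> 'v::plus set \<Rightarrow> 'w::plus set \<Rightarrow> ('v \<Rightarrow> 'w) \<Rightarrow> bool" where
  "linear_between s t V W h \<longleftrightarrow>
     h \<in> V \<rightarrow> W \<and>
     (\<forall>x\<in>V. \<forall>y\<in>V. h (x + y) = h x + h y) \<and>
     (\<forall>c. \<forall>x\<in>V. h (s c x) = t c (h x))"

locale copresheaf = vector_space scale
  for scale :: "'k::field \<Rightarrow> 'v::ab_group_add \<Rightarrow> 'v" +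
  fixes A :: "'i set set" and F :: "('i, 'v) functor_data"
  assumes subspace_obj: "\<alpha> \<in> A \<Longrightarrow> subspace (obj F \<alpha>)"
    and linear_res: "\<lbrakk>\<alpha> \<in> A; \<beta> \<in> A; \<beta> \<subseteq> \<alpha>\<rbrakk> \<Longrightarrow>
          linear_between scale scale (obj F \<alpha>) (obj F \<beta>) (res F \<alpha> \<beta>)"
    and res_id: "\<lbrakk>\<alpha> \<in> A; v \<in> obj F \<alpha>\<rbrakk> \<Longrightarrow> res F \<alpha> \<alpha> v = v"
    and res_comp: "\<lbrakk>\<alpha> \<in> A; \<beta> \<in> A; \<gamma> \<in> A; \<beta> \<subseteq> \<alpha>; \<gamma> \<subseteq> \<beta>; v \<in> obj F \<alpha>\<rbrakk> \<Longrightarrow>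
          res F \<beta> \<gamma> (res F \<alpha> \<beta> v) = res F \<alpha> \<gamma> v"

locale copresheaf_morphism =
  source: copresheaf s A F + target: copresheaf t A G
  for s :: "'k::field \<Rightarrow> 'v::ab_group_add \<Rightarrow> 'v" and t :: "'k \<Rightarrow> 'w::ab_group_add \<Rightarrow> 'w"
    and A :: "'i set set" and F :: "('i, 'v) functor_data" and G :: "('i, 'w) functor_data" +
  fixes h :: "'i set \<Rightarrow> 'v \<Rightarrow> 'w"
  assumes linear: "\<alpha> \<in> A \<Longrightarrow> linear_between s t (obj F \<alpha>) (obj G \<alpha>) (h \<alpha>)"
    and natural: "\<lbrakk>\<alpha> \<in> A; \<beta> \<in> A; \<beta> \<subseteq> \<alpha>; v \<in> obj F \<alpha>\<rbrakk> \<Longrightarrow>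
          h \<beta> (res F \<alpha> \<beta> v) = res G \<alpha> \<beta> (h \<alpha> v)"

text \<open>
  The stalk at \<open>\<alpha>\<close> of the sheaf on the Alexandrov space is \<open>obj F \<alpha>\<close>, so that surjectivity of a
  morphism of sheaves is surjectivity at every \<open>\<alpha>\<close>.
\<close>

locale copresheaf_surjection = copresheaf_morphism +
  assumes surj: "\<alpha> \<in> A \<Longrightarrow> h \<alpha> ` obj F \<alpha> = obj G \<alpha>"

locale copresheaf_isomorphism = copresheaf_morphism +
  assumes bij: "\<alpha> \<in> A \<Longrightarrow> bij_betw (h \<alpha>) (obj F \<alpha>) (obj G \<alpha>)"


section \<open>Restricted free copresheaves\<close>

text \<open>
  The vector space with basis a subset \<open>X\<close> of the type \<open>'a\<close> is the space of those
  \<open>v :: 'a \<Rightarrow>\<^sub>0 'k\<close> with \<open>keys v \<subseteq> X\<close>.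
\<close>

definition free_scale :: "'k::field \<Rightarrow> ('a \<Rightarrow>\<^sub>0 'k) \<Rightarrow> ('a \<Rightarrow>\<^sub>0 'k)" where
  "free_scale c v = Poly_Mapping.map ((*) c) v"

definition free_map :: "('a \<Rightarrow> 'b) \<Rightarrow> ('a \<Rightarrow>\<^sub>0 'k::field) \<Rightarrow> ('b \<Rightarrow>\<^sub>0 'k)" where
  "free_map p v = (\<Sum>x\<in>Poly_Mapping.keys v. Poly_Mapping.single (p x) (Poly_Mapping.lookup v x))"

definition coord_sum :: "('a \<Rightarrow>\<^sub>0 'k::field) \<Rightarrow> 'k" where
  "coord_sum v = (\<Sum>x\<in>Poly_Mapping.keys v. Poly_Mapping.lookup v x)"

definition restricted_free :: "('i \<Rightarrow> 'e set) \<Rightarrow> ('i, ('i \<Rightarrow> 'e) \<Rightarrow>\<^sub>0 'k::field) functor_data" where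
  "restricted_free E =
     \<lparr>obj = (\<lambda>\<alpha>. {v. Poly_Mapping.keys v \<subseteq> PiE \<alpha> E \<and> coord_sum v = 0}),
      res = (\<lambda>\<alpha> \<beta>. free_map (\<lambda>x. restrict x \<beta>))\<rparr>"

text \<open>
  The notion is taken up to natural isomorphism: the inverse image of \<open>restricted_free E'\<close> has the
  basis \<open>PiE (\<iota> \<alpha>) E'\<close> at \<open>\<alpha>\<close>, which is a product indexed by \<open>\<alpha>\<close> only after reindexing.
\<close>

definition restricted_free_copresheaf ::
  "('k::field \<Rightarrow> 'v::ab_group_add \<Rightarrow> 'v) \<Rightarrow> 'i set set \<Rightarrow> 'i set \<Rightarrow> ('i \<Rightarrow> 'e set) \<Rightarrow>
     ('i, 'v) functor_data \<Rightarrow> bool" where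
  "restricted_free_copresheaf scale A I E F \<longleftrightarrow>
     (\<forall>i\<in>I. E i \<noteq> {}) \<and>
     (\<exists>h. copresheaf_isomorphism free_scale scale A (restricted_free E) F h)"


section \<open>Sections, direct and inverse images\<close>

text \<open>Sections over \<open>W\<close> are extended by \<open>0\<close> outside \<open>W\<close>, so that they form a vector space of functions.\<close>

definition fun_scale :: "('k \<Rightarrow> 'v \<Rightarrow> 'v) \<Rightarrow> 'k \<Rightarrow> ('x \<Rightarrow> 'v) \<Rightarrow> ('x \<Rightarrow> 'v)" where
  "fun_scale scale c s = (\<lambda>x. scale c (s x))"

definition basic_open :: "'i set set \<Rightarrow> 'i set \<Rightarrow> 'i set set" where
  "basic_open A \<alpha> = {\<beta>\<in>A. \<beta> \<subseteq> \<alpha>}"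

definition sections :: "('i, 'v::zero) functor_data \<Rightarrow> 'i set set \<Rightarrow> ('i set \<Rightarrow> 'v) set" where
  "sections F W =
     {s. (\<forall>\<omega>\<in>W. s \<omega> \<in> obj F \<omega>) \<and> (\<forall>\<omega>. \<omega> \<notin> W \<longrightarrow> s \<omega> = 0) \<and>
         (\<forall>\<omega>\<in>W. \<forall>\<omega>'\<in>W. \<omega>' \<subseteq> \<omega> \<longrightarrow> res F \<omega> \<omega>' (s \<omega>) = s \<omega>')}"

definition H0 :: "'i set set \<Rightarrow> ('i, 'v::zero) functor_data \<Rightarrow> ('i set \<Rightarrow> 'v) set" where
  "H0 A F = sections F A"

definition preimage_open :: "'i set set \<Rightarrow> ('i set \<Rightarrow> 'j set) \<Rightarrow> 'j set set \<Rightarrow> 'i set set" where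
  "preimage_open A f W = {\<alpha>\<in>A. f \<alpha> \<in> W}"

definition restrict_section :: "'i set set \<Rightarrow> ('i set \<Rightarrow> 'v::zero) \<Rightarrow> ('i set \<Rightarrow> 'v)" where
  "restrict_section W s = (\<lambda>\<omega>. if \<omega> \<in> W then s \<omega> else 0)"

definition inverse_image ::
  "('i set \<Rightarrow> 'j set) \<Rightarrow> ('j, 'v) functor_data \<Rightarrow> ('i, 'v) functor_data" where
  "inverse_image f F' = \<lparr>obj = (\<lambda>\<alpha>. obj F' (f \<alpha>)), res = (\<lambda>\<alpha> \<beta>. res F' (f \<alpha>) (f \<beta>))\<rparr>"

definition direct_image ::
  "'i set set \<Rightarrow> 'j set set \<Rightarrow> ('i set \<Rightarrow> 'j set) \<Rightarrow> ('i, 'v::zero) functor_data \<Rightarrow>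
     ('j, 'i set \<Rightarrow> 'v) functor_data" where
  "direct_image A B f F =
     \<lparr>obj = (\<lambda>\<beta>. sections F (preimage_open A f (basic_open B \<beta>))),
      res = (\<lambda>\<beta> \<gamma>. restrict_section (preimage_open A f (basic_open B \<gamma>)))\<rparr>"

text \<open>
  The canonical map from sections of \<open>F'\<close> over \<open>W\<close> to sections of \<open>inverse_image f F'\<close> over the
  preimage of \<open>W\<close>, that is, to sections of its direct image over \<open>W\<close>.
\<close>

definition pullback_section ::
  "'i set set \<Rightarrow> ('i set \<Rightarrow> 'j set) \<Rightarrow> 'j set set \<Rightarrow> ('j set \<Rightarrow> 'v::zero) \<Rightarrow> ('i set \<Rightarrow> 'v)" where
  "pullback_section A f W s = restrict_section (preimage_open A f W) (\<lambda>\<alpha>. s (f \<alpha>))"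

text \<open>
  The unit \<open>F' \<rightarrow> f\<^sub>* f\<^sup>* F'\<close> of the adjunction: \<open>v\<close> in \<open>obj F' \<beta>\<close> is first turned into the section
  \<open>\<gamma> \<mapsto> res F' \<beta> \<gamma> v\<close> over \<open>basic_open B \<beta>\<close>.
\<close>

definition unit_map ::
  "'i set set \<Rightarrow> 'j set set \<Rightarrow> ('i set \<Rightarrow> 'j set) \<Rightarrow> ('j, 'v::zero) functor_data \<Rightarrow>
     'j set \<Rightarrow> 'v \<Rightarrow> ('i set \<Rightarrow> 'v)" where
  "unit_map A B f F' \<beta> v =
     pullback_section A f (basic_open B \<beta>) (restrict_section (basic_open B \<beta>) (\<lambda>\<gamma>. res F' \<beta> \<gamma> v))"

text \<open>The same map over the whole space \<open>B\<close>, whose preimage is \<open>A\<close>.\<close>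

definition H0_map ::
  "'i set set \<Rightarrow> 'j set set \<Rightarrow> ('i set \<Rightarrow> 'j set) \<Rightarrow> ('j set \<Rightarrow> 'v::zero) \<Rightarrow> ('i set \<Rightarrow> 'v)" where
  "H0_map A B f = pullback_section A f B"


section \<open>The concrete restricted free functor is a copresheaf\<close>

lemma lookup_free_scale [simp]:
  "Poly_Mapping.lookup (free_scale c v) x = c * Poly_Mapping.lookup v x"
  unfolding free_scale_def by transfer (simp add: when_def)

lemma vector_space_free_scale: "vector_space free_scale"
  by unfold_locales (auto intro!: poly_mapping_eqI simp: lookup_add algebra_simps)

lemma vector_space_fun_scale: "vector_space scale \<Longrightarrow> vector_space (fun_scale scale)"
  unfolding vector_space_def fun_scale_def by (auto simp: fun_eq_iff)

lemma keys_free_scale: "Poly_Mapping.keys (free_scale c v) \<subseteq> Poly_Mapping.keys v"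
  by (auto simp: in_keys_iff)

lemma free_map_superset:
  assumes "finite X" "Poly_Mapping.keys v \<subseteq> X"
  shows "free_map p v = (\<Sum>x\<in>X. Poly_Mapping.single (p x) (Poly_Mapping.lookup v x))"
  unfolding free_map_def
  by (rule sum.mono_neutral_left) (use assms in \<open>auto simp: in_keys_iff\<close>)

lemma coord_sum_superset:
  assumes "finite X" "Poly_Mapping.keys v \<subseteq> X"
  shows "coord_sum v = (\<Sum>x\<in>X. Poly_Mapping.lookup v x)"
  unfolding coord_sum_def
  by (rule sum.mono_neutral_left) (use assms in \<open>auto simp: in_keys_iff\<close>)

lemma free_map_add: "free_map p (v + w) = free_map p v + free_map p w"
proof -
  let ?X = "Poly_Mapping.keys v \<union> Poly_Mapping.keys w"
  show ?thesis
    using free_map_superset[of ?X v p] free_map_superset[of ?X w p]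
      free_map_superset[of ?X "v + w" p] Poly_Mapping.keys_add[of v w]
    by (simp add: lookup_add single_add sum.distrib)
qed

lemma free_scale_sum: "free_scale c (sum g X) = (\<Sum>x\<in>X. free_scale c (g x))"
  by (rule poly_mapping_eqI) (simp add: lookup_sum sum_distrib_left)

lemma free_map_scale: "free_map p (free_scale c v) = free_scale c (free_map p v)"
proof -
  have "free_map p (free_scale c v) =
      (\<Sum>x\<in>Poly_Mapping.keys v. Poly_Mapping.single (p x) (c * Poly_Mapping.lookup v x))"
    using free_map_superset[OF _ keys_free_scale, of v p c] by simp
  also have "\<dots> = (\<Sum>x\<in>Poly_Mapping.keys v.
      free_scale c (Poly_Mapping.single (p x) (Poly_Mapping.lookup v x)))"
    by (intro sum.cong refl poly_mapping_eqI) (simp add: lookup_single when_def)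
  finally show ?thesis by (simp add: free_map_def free_scale_sum)
qed

lemma coord_sum_add: "coord_sum (v + w) = coord_sum v + coord_sum w"
proof -
  let ?X = "Poly_Mapping.keys v \<union> Poly_Mapping.keys w"
  show ?thesis
    using coord_sum_superset[of ?X v] coord_sum_superset[of ?X w]
      coord_sum_superset[of ?X "v + w"] Poly_Mapping.keys_add[of v w]
    by (simp add: lookup_add sum.distrib)
qed

lemma coord_sum_scale: "coord_sum (free_scale c v) = c * coord_sum v"
  using coord_sum_superset[OF _ keys_free_scale, of v c]
  by (simp add: coord_sum_def sum_distrib_left)

lemma free_map_zero [simp]: "free_map p 0 = 0"
  by (simp add: free_map_def)

lemma coord_sum_zero [simp]: "coord_sum 0 = 0"
  by (simp add: coord_sum_def)

lemma free_map_single [simp]: "free_map p (Poly_Mapping.single x c) = Poly_Mapping.single (p x) c"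
  by (simp add: free_map_def)

lemma coord_sum_single [simp]: "coord_sum (Poly_Mapping.single x c) = c"
  by (simp add: coord_sum_def)

lemma free_map_sum: "free_map p (sum g X) = (\<Sum>x\<in>X. free_map p (g x))"
  by (induction X rule: infinite_finite_induct) (simp_all add: free_map_add)

lemma coord_sum_sum: "coord_sum (sum g X) = (\<Sum>x\<in>X. coord_sum (g x))"
  by (induction X rule: infinite_finite_induct) (simp_all add: coord_sum_add)

lemma coord_sum_free_map: "coord_sum (free_map p v) = coord_sum v"
  by (simp add: free_map_def coord_sum_sum) (simp add: coord_sum_def)

lemma free_map_comp: "free_map q (free_map p v) = free_map (\<lambda>x. q (p x)) v"
  by (simp add: free_map_def[of p v] free_map_sum) (simp add: free_map_def)

lemma free_map_cong:
  "(\<And>x. x \<in> Poly_Mapping.keys v \<Longrightarrow> p x = q x) \<Longrightarrow> free_map p v = free_map q v"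
  unfolding free_map_def by (intro sum.cong) auto

lemma keys_free_map: "Poly_Mapping.keys (free_map p v) \<subseteq> p ` Poly_Mapping.keys v"
proof -
  have "Poly_Mapping.keys (free_map p v) \<subseteq>
      (\<Union>x\<in>Poly_Mapping.keys v. Poly_Mapping.keys (Poly_Mapping.single (p x) (Poly_Mapping.lookup v x)))"
    unfolding free_map_def by (rule Poly_Mapping.keys_sum)
  then show ?thesis by (auto split: if_splits)
qed

lemma free_map_ident: "free_map (\<lambda>x. x) v = v"
  by (rule poly_mapping_eqI)
     (simp add: free_map_def lookup_sum lookup_single when_def in_keys_iff)

lemma obj_restricted_free [simp]:
  "v \<in> obj (restricted_free E) \<alpha> \<longleftrightarrow> Poly_Mapping.keys v \<subseteq> PiE \<alpha> E \<and> coord_sum v = 0"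
  by (simp add: restricted_free_def)

lemma res_restricted_free [simp]:
  "res (restricted_free E) \<alpha> \<beta> = free_map (\<lambda>x. restrict x \<beta>)"
  by (simp add: restricted_free_def)

lemma keys_res_restricted_free:
  assumes "Poly_Mapping.keys v \<subseteq> PiE \<alpha> E" "\<beta> \<subseteq> \<alpha>"
  shows "Poly_Mapping.keys (free_map (\<lambda>x. restrict x \<beta>) v) \<subseteq> PiE \<beta> E"
proof -
  have "restrict x \<beta> \<in> PiE \<beta> E" if "x \<in> PiE \<alpha> E" for x
    using that assms(2) by (simp add: PiE_def Pi_def subset_iff)
  then show ?thesis using keys_free_map[of "\<lambda>x. restrict x \<beta>" v] assms(1) by blast
qed

lemma copresheaf_restricted_free:
  fixes E :: "'i \<Rightarrow> 'e set"
  shows "copresheaf (free_scale :: 'k::field \<Rightarrow> _) A (restricted_free E)"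
proof (intro copresheaf.intro copresheaf_axioms.intro vector_space_free_scale)
  fix \<alpha> :: "'i set"
  interpret vector_space "free_scale :: 'k \<Rightarrow> (('i \<Rightarrow> 'e) \<Rightarrow>\<^sub>0 'k) \<Rightarrow> _"
    by (rule vector_space_free_scale)
  show "module.subspace (free_scale :: 'k \<Rightarrow> _) (obj (restricted_free E) \<alpha>)"
  proof (rule subspaceI)
    show "(0 :: ('i \<Rightarrow> 'e) \<Rightarrow>\<^sub>0 'k) \<in> obj (restricted_free E) \<alpha>" by simp
  next
    fix v w :: "('i \<Rightarrow> 'e) \<Rightarrow>\<^sub>0 'k"
    assume "v \<in> obj (restricted_free E) \<alpha>" "w \<in> obj (restricted_free E) \<alpha>"
    then show "v + w \<in> obj (restricted_free E) \<alpha>"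
      using subset_trans[OF Poly_Mapping.keys_add[of v w]] by (simp add: coord_sum_add)
  next
    fix c and v :: "('i \<Rightarrow> 'e) \<Rightarrow>\<^sub>0 'k"
    assume v: "v \<in> obj (restricted_free E) \<alpha>"
    then have "Poly_Mapping.keys (free_scale c v) \<subseteq> PiE \<alpha> E"
      by (meson keys_free_scale obj_restricted_free subset_trans)
    with v show "free_scale c v \<in> obj (restricted_free E) \<alpha>" by (simp add: coord_sum_scale)
  qed
next
  fix \<alpha> \<beta> :: "'i set" assume sub: "\<beta> \<subseteq> \<alpha>"
  show "linear_between (free_scale :: 'k \<Rightarrow> _) free_scale (obj (restricted_free E) \<alpha>)
      (obj (restricted_free E) \<beta>) (res (restricted_free E) \<alpha> \<beta>)"
    unfolding linear_between_def
    by (simp add: Pi_iff Ball_def free_map_add free_map_scale coord_sum_free_map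
        keys_res_restricted_free[OF _ sub])
next
  fix \<alpha> :: "'i set" and v :: "('i \<Rightarrow> 'e) \<Rightarrow>\<^sub>0 'k"
  assume v: "v \<in> obj (restricted_free E) \<alpha>"
  have "free_map (\<lambda>x. restrict x \<alpha>) v = free_map (\<lambda>x. x) v"
  proof (rule free_map_cong)
    fix x assume "x \<in> Poly_Mapping.keys v"
    then have "x \<in> PiE \<alpha> E" using v by (simp add: subset_iff)
    then show "restrict x \<alpha> = x" by (rule PiE_restrict)
  qed
  then show "res (restricted_free E) \<alpha> \<alpha> v = v" by (simp add: free_map_ident)
next
  fix \<alpha> \<beta> \<gamma> :: "'i set" and v :: "('i \<Rightarrow> 'e) \<Rightarrow>\<^sub>0 'k"
  assume "\<gamma> \<subseteq> \<beta>"
  then have "restrict (restrict x \<beta>) \<gamma> = restrict x \<gamma>" for x :: "'i \<Rightarrow> 'e"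
    by (auto simp: restrict_def fun_eq_iff)
  then show "res (restricted_free E) \<beta> \<gamma> (res (restricted_free E) \<alpha> \<beta> v) =
      res (restricted_free E) \<alpha> \<gamma> v"
    by (simp only: res_restricted_free free_map_comp)
qed

lemma restricted_free_copresheaf_restricted_free:
  assumes "\<And>i. i \<in> I \<Longrightarrow> E i \<noteq> {}"
  shows "restricted_free_copresheaf free_scale A I E (restricted_free E)"
proof -
  interpret copresheaf free_scale A "restricted_free E"
    by (rule copresheaf_restricted_free)
  have "copresheaf_isomorphism free_scale free_scale A (restricted_free E) (restricted_free E) (\<lambda>_ v. v)"
    by unfold_locales (auto simp: linear_between_def bij_betw_def)
  then show ?thesis using assms by (auto simp: restricted_free_copresheaf_def)
qed

end

theory Submission
  imports Defs
begin

text \<open>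
  After a choice of base points, replacing by them all coordinates outside \<open>\<delta>\<close> gives projectors
  \<open>P \<delta>\<close> with \<open>P \<gamma> \<circ> P \<delta> = P (\<gamma> \<inter> \<delta>)\<close>, which split a restricted free copresheaf into components
  indexed by non-empty sets \<open>\<gamma>\<close>; the \<open>\<gamma>\<close>-component contributes to \<open>\<beta>\<close> exactly if \<open>\<gamma> \<subseteq> \<beta>\<close>.  By the
  weak intersection property, the members of a hypergraph \<open>C\<close> above a fixed \<open>\<gamma>\<close> are closed under
  intersection, so that a section over \<open>C\<close> has one well-defined \<open>\<gamma>\<close>-component for each non-empty
  \<open>\<gamma>\<close> below a member of \<open>C\<close>.  Setting the other components to zero extends it to all finite sets.
  Both surjectivity claims are instances: \<open>C\<close> is the image of \<open>\<A>\<close>, or the part of it below \<open>\<beta>\<close>.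
\<close>

section \<open>Moebius components and the extension of compatible families\<close>

text \<open>
  Moebius inversion on \<open>K\<close>, written as a recursion: on \<open>K\<close> the value \<open>y \<gamma>\<close> is the sum of the
  components of the subsets of \<open>\<gamma>\<close>.
\<close>

function component :: "'j set set \<Rightarrow> ('j set \<Rightarrow> 'v::ab_group_add) \<Rightarrow> 'j set \<Rightarrow> 'v" where
  "component K y \<gamma> =
     (if finite \<gamma> \<and> \<gamma> \<in> K then y \<gamma> - (\<Sum>\<delta> | \<delta> \<subset> \<gamma>. component K y \<delta>) else 0)"
  by auto
termination
  by (relation "measure (\<lambda>(K, y, \<gamma>). card \<gamma>)") (auto intro: psubset_card_mono)

declare component.simps [simp del]

text \<open>The summand of \<gamma> itself is \<open>y \<gamma>\<close> minus the summands of all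
  proper subsets: the inversion formula read backwards.\<close>

lemma sum_component:
  assumes "finite \<gamma>" "\<gamma> \<in> K"
  shows "(\<Sum>\<delta> | \<delta> \<subseteq> \<gamma>. component K y \<delta>) = y \<gamma>"
proof -
  have "{\<delta>. \<delta> \<subseteq> \<gamma>} = insert \<gamma> {\<delta>. \<delta> \<subset> \<gamma>}" by auto
  moreover have "finite {\<delta>. \<delta> \<subset> \<gamma>}"
    by (rule finite_subset[of _ "Pow \<gamma>"]) (use assms in auto)
  ultimately show ?thesis using assms by (simp add: component.simps[of K y \<gamma>])
qed

text \<open>Induction on \<gamma> along proper subsets: \<open>P \<delta>\<close> keeps the
  components of those proper subsets that lie below \<delta> and kills the others. If \<gamma>
  \<subseteq> \<delta>, nothing changes. Otherwise the kept ones belong to all subsets of \<delta>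
  \<inter> \<gamma>, and their sum is exactly \<open>P \<delta> (y \<gamma>)\<close>, so that
  everything cancels.\<close>

lemma projector_component:
  fixes P :: "'j set \<Rightarrow> 'v::ab_group_add \<Rightarrow> 'v"
  assumes add: "\<And>\<delta> v w. P \<delta> (v + w) = P \<delta> v + P \<delta> w"
    and down: "\<And>\<gamma> \<delta>. \<gamma> \<in> K \<Longrightarrow> \<delta> \<subseteq> \<gamma> \<Longrightarrow> \<delta> \<noteq> {} \<Longrightarrow> \<delta> \<in> K"
    and empty: "{} \<notin> K"
    and proj: "\<And>\<gamma> \<delta>. \<gamma> \<in> K \<Longrightarrow> P \<delta> (y \<gamma>) = (if \<delta> \<inter> \<gamma> = {} then 0 else y (\<delta> \<inter> \<gamma>))"
  shows "P \<delta> (component K y \<gamma>) = (if \<gamma> \<subseteq> \<delta> then component K y \<gamma> else 0)"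
proof (cases "finite \<gamma>")
  case False
  interpret additive "P \<delta>" by unfold_locales (rule add)
  show ?thesis using False by (simp add: component.simps zero)
next
  case True
  interpret additive "P \<delta>" by unfold_locales (rule add)
  from True show ?thesis
  proof (induction \<gamma> rule: finite_psubset_induct)
    case (psubset \<gamma>)
    show ?case
    proof (cases "\<gamma> \<in> K")
      case False
      then show ?thesis by (simp add: component.simps zero)
    next
      case K: True
      have eq: "component K y \<gamma> = y \<gamma> - (\<Sum>\<epsilon> | \<epsilon> \<subset> \<gamma>. component K y \<epsilon>)"
        using K psubset.hyps by (simp add: component.simps[of K y \<gamma>])
      have fin: "finite {\<epsilon>. \<epsilon> \<subset> \<gamma>}"
        by (rule finite_subset[of _ "Pow \<gamma>"]) (use psubset.hyps in auto)
      have "P \<delta> (component K y \<gamma>) =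
          P \<delta> (y \<gamma>) - (\<Sum>\<epsilon> | \<epsilon> \<subset> \<gamma>. if \<epsilon> \<subseteq> \<delta> then component K y \<epsilon> else 0)"
        unfolding eq diff sum by (intro arg_cong2[of _ _ _ _ "(-)"] sum.cong) (auto simp: psubset.IH)
      also have "\<dots> = P \<delta> (y \<gamma>) - (\<Sum>\<epsilon> | \<epsilon> \<subset> \<gamma> \<and> \<epsilon> \<subseteq> \<delta>. component K y \<epsilon>)"
        using fin by (simp add: sum.inter_filter[symmetric])
      also have "\<dots> = (if \<gamma> \<subseteq> \<delta> then component K y \<gamma> else 0)"
      proof (cases "\<gamma> \<subseteq> \<delta>")
        case True
        then have "{\<epsilon>. \<epsilon> \<subset> \<gamma> \<and> \<epsilon> \<subseteq> \<delta>} = {\<epsilon>. \<epsilon> \<subset> \<gamma>}" "\<delta> \<inter> \<gamma> = \<gamma>" by auto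
        then show ?thesis using True K empty by (auto simp: eq proj)
      next
        case False
        \<comment> \<open>As \<gamma> is not below \<delta>, every subset of \<delta> \<inter>
          \<gamma> is automatically proper in \<gamma>, and the sum runs over a full power
          set.\<close>
        then have set: "{\<epsilon>. \<epsilon> \<subset> \<gamma> \<and> \<epsilon> \<subseteq> \<delta>} = {\<epsilon>. \<epsilon> \<subseteq> \<delta> \<inter> \<gamma>}" by auto
        show ?thesis
        proof (cases "\<delta> \<inter> \<gamma> = {}")
          case True
          \<comment> \<open>Only the empty index remains, and its component is 0 because
            \<open>{}\<close> is not in \<open>K\<close>.\<close>
          then show ?thesis using False K empty unfolding set
            by (simp add: proj component.simps)
        next
          case ne: False
          then have "\<delta> \<inter> \<gamma> \<in> K" using down[OF K] by simp
          then show ?thesis using False K ne psubset.hyps sum_component[of "\<delta> \<inter> \<gamma>" K y]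
            unfolding set by (simp add: proj)
        qed
      qed
      finally show ?thesis .
    qed
  qed
qed

text \<open>The family \<open>t\<close> adds up the components of the subsets of its argument, and
  \<open>P \<delta>\<close> selects those below \<delta>. The weak intersection property says
  nothing about disjoint members of \<open>C\<close>; for them the condition
  \<open>P {} (u \<alpha>) = 0\<close> takes over.\<close>

lemma compatible_family_extends:
  fixes P :: "'j set \<Rightarrow> 'v::ab_group_add \<Rightarrow> 'v"
  assumes add: "\<And>\<delta> v w. P \<delta> (v + w) = P \<delta> v + P \<delta> w"
    and comp: "\<And>\<gamma> \<delta> v. P \<gamma> (P \<delta> v) = P (\<gamma> \<inter> \<delta>) v"
    and fin: "\<And>\<alpha>. \<alpha> \<in> C \<Longrightarrow> finite \<alpha>"
    and wip: "weak_intersection_property C"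
    and compat: "\<And>\<alpha> \<beta>. \<alpha> \<in> C \<Longrightarrow> \<beta> \<in> C \<Longrightarrow> \<beta> \<subseteq> \<alpha> \<Longrightarrow> P \<beta> (u \<alpha>) = u \<beta>"
    and zero: "\<And>\<alpha>. \<alpha> \<in> C \<Longrightarrow> P {} (u \<alpha>) = 0"
  obtains t where "\<And>\<beta> \<delta>. finite \<beta> \<Longrightarrow> P \<delta> (t \<beta>) = t (\<delta> \<inter> \<beta>)"
    and "\<And>\<alpha>. \<alpha> \<in> C \<Longrightarrow> t \<alpha> = u \<alpha>" and "t {} = 0"
proof -
  define K where "K = {\<gamma>. \<gamma> \<noteq> {} \<and> (\<exists>\<alpha>\<in>C. \<gamma> \<subseteq> \<alpha>)}"
  \<comment> \<open>The value at \<gamma> is read off from some member of \<open>C\<close> above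
    \<gamma>; for \<gamma> in \<open>K\<close>, \<open>indep\<close> makes the choice
    immaterial.\<close>
  define y where "y \<gamma> = P \<gamma> (u (SOME \<alpha>. \<alpha> \<in> C \<and> \<gamma> \<subseteq> \<alpha>))" for \<gamma>
  have indep: "P \<gamma> (u \<alpha>) = P \<gamma> (u \<alpha>')"
    if "\<alpha> \<in> C" "\<alpha>' \<in> C" "\<gamma> \<subseteq> \<alpha>" "\<gamma> \<subseteq> \<alpha>'" "\<gamma> \<noteq> {}" for \<gamma> \<alpha> \<alpha>'
  proof -
    \<comment> \<open>Both members contain the non-empty \<gamma>, so their intersection lies in
      \<open>C\<close>. The family has one value there, and \<open>P \<gamma>\<close> factors
      through it.\<close>
    have "\<alpha> \<inter> \<alpha>' \<in> C" using that wip unfolding weak_intersection_property_def by blast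
    then have "P (\<alpha> \<inter> \<alpha>') (u \<alpha>) = P (\<alpha> \<inter> \<alpha>') (u \<alpha>')" using that by (simp add: compat)
    then have "P \<gamma> (P (\<alpha> \<inter> \<alpha>') (u \<alpha>)) = P \<gamma> (P (\<alpha> \<inter> \<alpha>') (u \<alpha>'))" by simp
    moreover have "\<gamma> \<inter> (\<alpha> \<inter> \<alpha>') = \<gamma>" using that by blast
    ultimately show ?thesis by (simp add: comp)
  qed
  have y: "y \<gamma> = P \<gamma> (u \<alpha>)" if "\<alpha> \<in> C" "\<gamma> \<subseteq> \<alpha>" "\<gamma> \<noteq> {}" for \<gamma> \<alpha>
  proof -
    have "(SOME \<alpha>. \<alpha> \<in> C \<and> \<gamma> \<subseteq> \<alpha>) \<in> C \<and> \<gamma> \<subseteq> (SOME \<alpha>. \<alpha> \<in> C \<and> \<gamma> \<subseteq> \<alpha>)"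
      by (rule someI[of _ \<alpha>]) (use that in auto)
    then show ?thesis unfolding y_def using indep that by blast
  qed
  have down: "\<delta> \<in> K" if "\<gamma> \<in> K" "\<delta> \<subseteq> \<gamma>" "\<delta> \<noteq> {}" for \<gamma> \<delta>
    using that unfolding K_def by blast
  have empty: "{} \<notin> K" by (simp add: K_def)
  have proj: "P \<delta> (y \<gamma>) = (if \<delta> \<inter> \<gamma> = {} then 0 else y (\<delta> \<inter> \<gamma>))" if K: "\<gamma> \<in> K" for \<gamma> \<delta>
  proof -
    obtain \<alpha> where \<alpha>: "\<alpha> \<in> C" "\<gamma> \<subseteq> \<alpha>" "\<gamma> \<noteq> {}" using K by (auto simp: K_def)
    then have "\<delta> \<inter> \<gamma> \<subseteq> \<alpha>" by blast
    \<comment> \<open>Here \<open>P \<delta> (y \<gamma>)\<close> is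
      \<open>P (\<delta> \<inter> \<gamma>) (u \<alpha>)\<close>; for disjoint \<delta> and \<gamma>
      this is \<open>P {} (u \<alpha>)\<close>, hence 0.\<close>
    then show ?thesis using \<alpha> y[of \<alpha> "\<delta> \<inter> \<gamma>"] by (simp add: y comp zero)
  qed
  \<comment> \<open>Indices outside \<open>K\<close> contribute 0, which is the extension by zero
    components. For infinite \<beta> the sum itself defaults to 0, whence the restriction to finite
    \<beta> below.\<close>
  define t where "t \<beta> = (\<Sum>\<gamma> | \<gamma> \<subseteq> \<beta>. component K y \<gamma>)" for \<beta>
  have component: "P \<delta> (component K y \<gamma>) = (if \<gamma> \<subseteq> \<delta> then component K y \<gamma> else 0)" for \<gamma> \<delta>
    by (rule projector_component[where P = P, OF add down empty proj])
  show ?thesis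
  proof
    fix \<beta> \<delta> :: "'j set" assume "finite \<beta>"
    interpret additive "P \<delta>" by unfold_locales (rule add)
    have "P \<delta> (t \<beta>) = (\<Sum>\<gamma>\<in>Pow \<beta>. if \<gamma> \<subseteq> \<delta> then component K y \<gamma> else 0)"
      by (simp add: t_def sum component Pow_def)
    also have "\<dots> = (\<Sum>\<gamma> | \<gamma> \<in> Pow \<beta> \<and> \<gamma> \<subseteq> \<delta>. component K y \<gamma>)"
      using \<open>finite \<beta>\<close> by (intro sum.inter_filter[symmetric]) simp
    also have "{\<gamma> \<in> Pow \<beta>. \<gamma> \<subseteq> \<delta>} = {\<gamma>. \<gamma> \<subseteq> \<delta> \<inter> \<beta>}" by auto
    finally show "P \<delta> (t \<beta>) = t (\<delta> \<inter> \<beta>)" by (simp add: t_def)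
  next
    show t0: "t {} = 0" using empty by (simp add: t_def component.simps)
    fix \<alpha> assume \<alpha>: "\<alpha> \<in> C"
    show "t \<alpha> = u \<alpha>"
    proof (cases "\<alpha> = {}")
      case True
      \<comment> \<open>The empty set may belong to \<open>C\<close>; then \<open>u {}\<close>
        equals \<open>P {} (u {})\<close>, which is 0.\<close>
      then show ?thesis using \<alpha> t0 compat[of "{}" "{}"] zero[of "{}"] by simp
    next
      case False
      then have "\<alpha> \<in> K" using \<alpha> by (auto simp: K_def)
      then show ?thesis using \<alpha> False fin by (simp add: t_def sum_component y compat)
    qed
  qed
qed

section \<open>Extension of families in restricted free copresheaves\<close>

lemma keys_free_map_subset:
  assumes "Poly_Mapping.keys v \<subseteq> X" and "\<And>x. x \<in> X \<Longrightarrow> p x \<in> Y"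
  shows "Poly_Mapping.keys (free_map p v) \<subseteq> Y"
  using keys_free_map[of p v] assms by blast

text \<open>The basis elements at \<alpha> are functions left undefined outside \<alpha>, whereas
  the projectors need one common space. So \<open>P \<alpha>\<close> first fills in base points, the
  extension is made among total functions, and restriction to \<beta> brings its value back to the
  object at \<beta>.\<close>

lemma restricted_free_family_extends:
  fixes E :: "'j \<Rightarrow> 'e set" and s :: "'j set \<Rightarrow> (('j \<Rightarrow> 'e) \<Rightarrow>\<^sub>0 'k::field)"
  assumes ne: "\<And>j. j \<in> J \<Longrightarrow> E j \<noteq> {}"
    and hyp: "hypergraph C J"
    and wip: "weak_intersection_property C"
    and obj: "\<And>\<alpha>. \<alpha> \<in> C \<Longrightarrow> s \<alpha> \<in> obj (restricted_free E) \<alpha>"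
    and compat: "\<And>\<alpha> \<beta>. \<alpha> \<in> C \<Longrightarrow> \<beta> \<in> C \<Longrightarrow> \<beta> \<subseteq> \<alpha> \<Longrightarrow>
      res (restricted_free E) \<alpha> \<beta> (s \<alpha>) = s \<beta>"
  obtains t where
    "\<And>\<beta>. finite \<beta> \<Longrightarrow> \<beta> \<subseteq> J \<Longrightarrow> t \<beta> \<in> obj (restricted_free E) \<beta>"
    "\<And>\<beta> \<gamma>. finite \<beta> \<Longrightarrow> \<gamma> \<subseteq> \<beta> \<Longrightarrow> res (restricted_free E) \<beta> \<gamma> (t \<beta>) = t \<gamma>"
    "\<And>\<alpha>. \<alpha> \<in> C \<Longrightarrow> t \<alpha> = s \<alpha>"
proof -
  define e where "e j = (SOME x. x \<in> E j)" for j
  have e: "e j \<in> E j" if "j \<in> J" for j using ne[OF that] unfolding e_def by (simp add: some_in_eq)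
  \<comment> \<open>The test \<open>x j \<in> E j\<close> forces the image of \<open>P \<delta>\<close> to have its \<open>\<delta>\<close>-coordinates in \<open>E\<close>.\<close>
  define p where "p \<delta> x = (\<lambda>j. if j \<in> \<delta> \<and> x j \<in> E j then x j else e j)"
    for \<delta> and x :: "'j \<Rightarrow> 'e"
  define P :: "'j set \<Rightarrow> (('j \<Rightarrow> 'e) \<Rightarrow>\<^sub>0 'k) \<Rightarrow> (('j \<Rightarrow> 'e) \<Rightarrow>\<^sub>0 'k)"
    where "P \<delta> = free_map (p \<delta>)" for \<delta>
  \<comment> \<open>All basis elements collapse to \<open>e\<close>. Hence the zero-sum condition of
    a restricted free copresheaf is the same as \<open>P {} v = 0\<close>.\<close>
  have P_empty: "P {} v = Poly_Mapping.single e (coord_sum v)" for v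
    unfolding P_def free_map_def p_def coord_sum_def
    by (rule poly_mapping_eqI) (simp add: lookup_sum lookup_single when_def)
  \<comment> \<open>A coordinate once replaced by \<open>e j\<close> stays \<open>e j\<close>,
    whether or not it passes the membership test.\<close>
  have comp: "P \<gamma> (P \<delta> v) = P (\<gamma> \<inter> \<delta>) v" for \<gamma> \<delta> v
    unfolding P_def free_map_comp by (rule free_map_cong) (auto simp: p_def fun_eq_iff)
  \<comment> \<open>Restriction to \<gamma> alters only coordinates that \<open>P \<beta>\<close>
    overwrites anyway. Dually, in \<open>res_P\<close>, the two projectors differ only at
    coordinates that restriction to \<gamma> discards.\<close>
  have P_res: "P \<beta> (free_map (\<lambda>x. restrict x \<gamma>) v) = P \<beta> v" if "\<beta> \<subseteq> \<gamma>" for \<beta> \<gamma> v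
    unfolding P_def free_map_comp by (rule free_map_cong) (use that in \<open>auto simp: p_def fun_eq_iff\<close>)
  have res_P: "free_map (\<lambda>x. restrict x \<gamma>) (P \<beta> v) = free_map (\<lambda>x. restrict x \<gamma>) (P \<gamma> v)"
    if "\<gamma> \<subseteq> \<beta>" for \<beta> \<gamma> v
    unfolding P_def free_map_comp by (rule free_map_cong) (use that in \<open>auto simp: p_def fun_eq_iff\<close>)
  define u where "u \<alpha> = P \<alpha> (s \<alpha>)" for \<alpha>
  obtain t where t: "\<And>\<beta> \<delta>. finite \<beta> \<Longrightarrow> P \<delta> (t \<beta>) = t (\<delta> \<inter> \<beta>)"
    and tu: "\<And>\<alpha>. \<alpha> \<in> C \<Longrightarrow> t \<alpha> = u \<alpha>" and t0: "t {} = 0"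
  proof (rule compatible_family_extends[of P C u])
    show "P \<delta> (v + w) = P \<delta> v + P \<delta> w" for \<delta> v w by (simp add: P_def free_map_add)
    show "P \<gamma> (P \<delta> v) = P (\<gamma> \<inter> \<delta>) v" for \<gamma> \<delta> v by (rule comp)
    show "weak_intersection_property C" by (rule wip)
    show "finite \<alpha>" if "\<alpha> \<in> C" for \<alpha> using that hyp by (simp add: hypergraph_def)
    show "P \<beta> (u \<alpha>) = u \<beta>" if "\<alpha> \<in> C" "\<beta> \<in> C" "\<beta> \<subseteq> \<alpha>" for \<alpha> \<beta>
    proof -
      have "u \<beta> = P \<beta> (free_map (\<lambda>x. restrict x \<beta>) (s \<alpha>))"
        using compat[OF that] by (simp add: u_def)
      also have "\<dots> = P (\<beta> \<inter> \<alpha>) (s \<alpha>)" using that by (simp add: P_res Int_absorb2)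
      finally show ?thesis by (simp add: u_def comp)
    qed
    show "P {} (u \<alpha>) = 0" if "\<alpha> \<in> C" for \<alpha>
      using obj[OF that] by (simp add: u_def comp P_empty)
  qed (rule that)
  define r :: "'j set \<Rightarrow> (('j \<Rightarrow> 'e) \<Rightarrow>\<^sub>0 'k) \<Rightarrow> _"
    where "r \<beta> = free_map (\<lambda>x. restrict x \<beta>)" for \<beta>
  show ?thesis
  proof
    fix \<beta> assume \<beta>: "finite \<beta>" "\<beta> \<subseteq> J"
    have "Poly_Mapping.single e (coord_sum (t \<beta>)) = 0"
      using t[OF \<beta>(1), of "{}"] t0 by (simp add: P_empty)
    then have "coord_sum (t \<beta>) = 0" by (metis coord_sum_single coord_sum_zero)
    \<comment> \<open>The test in \<open>p\<close> and the base points put the coordinates in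
      \<beta> into \<open>E\<close>, whatever the argument; and \<open>t \<beta>\<close> is fixed by
      \<open>P \<beta>\<close>.\<close>
    moreover have "Poly_Mapping.keys (r \<beta> (P \<beta> (t \<beta>))) \<subseteq> PiE \<beta> E"
    proof -
      have "restrict (p \<beta> x) \<beta> \<in> PiE \<beta> E" for x using \<beta> e by (auto simp: p_def)
      then show ?thesis unfolding r_def P_def free_map_comp
        by (intro keys_free_map_subset[OF subset_UNIV])
    qed
    ultimately show "r \<beta> (t \<beta>) \<in> obj (restricted_free E) \<beta>"
      using t[OF \<beta>(1), of \<beta>] by (simp add: r_def coord_sum_free_map)
  next
    fix \<beta> \<gamma> :: "'j set" assume \<beta>: "finite \<beta>" "\<gamma> \<subseteq> \<beta>"
    then have fin: "finite \<gamma>" using finite_subset by blast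
    have "restrict (restrict x \<beta>) \<gamma> = restrict x \<gamma>" for x :: "'j \<Rightarrow> 'e"
      using \<beta> by (auto simp: restrict_def fun_eq_iff)
    then have "res (restricted_free E) \<beta> \<gamma> (r \<beta> (t \<beta>)) = r \<gamma> (P \<beta> (t \<beta>))"
      using t[OF \<beta>(1), of \<beta>] by (simp add: r_def free_map_comp)
    also have "\<dots> = r \<gamma> (t \<gamma>)"
      using \<beta> res_P[OF \<beta>(2)] t[OF \<beta>(1), of \<gamma>] by (simp add: r_def Int_absorb2)
    finally show "res (restricted_free E) \<beta> \<gamma> (r \<beta> (t \<beta>)) = r \<gamma> (t \<gamma>)" .
  next
    fix \<alpha> assume \<alpha>: "\<alpha> \<in> C"
    \<comment> \<open>On the keys of \<open>s \<alpha>\<close>, filling in base points and cutting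
      them off again is the identity, since the coordinates pass the test and are undefined outside
      \<alpha>.\<close>
    have "r \<alpha> (t \<alpha>) = free_map (\<lambda>x. x) (s \<alpha>)"
      unfolding tu[OF \<alpha>] u_def r_def P_def free_map_comp
    proof (rule free_map_cong)
      fix x assume "x \<in> Poly_Mapping.keys (s \<alpha>)"
      then have "x \<in> PiE \<alpha> E" using obj[OF \<alpha>] by (auto simp: subset_iff)
      then show "restrict (p \<alpha> x) \<alpha> = x"
        by (auto simp: p_def fun_eq_iff PiE_def Pi_def extensional_def)
    qed
    then show "r \<alpha> (t \<alpha>) = s \<alpha>" by (simp add: free_map_ident)
  qed
qed

text \<open>Transport along the isomorphism \<open>h\<close> with the concrete functor: pull the
  family back by the pointwise inverse \<open>g\<close>, extend, and push forward. Naturality of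
  \<open>h\<close> together with its injectivity makes the pulled-back family compatible.\<close>

lemma restricted_free_copresheaf_family_extends:
  fixes F :: "('j, 'v::ab_group_add) functor_data"
  assumes F: "restricted_free_copresheaf scale B J E F"
    and hyp: "hypergraph B J"
    and CB: "C \<subseteq> B" and wip: "weak_intersection_property C"
    and obj: "\<And>\<alpha>. \<alpha> \<in> C \<Longrightarrow> s \<alpha> \<in> obj F \<alpha>"
    and compat: "\<And>\<alpha> \<beta>. \<alpha> \<in> C \<Longrightarrow> \<beta> \<in> C \<Longrightarrow> \<beta> \<subseteq> \<alpha> \<Longrightarrow> res F \<alpha> \<beta> (s \<alpha>) = s \<beta>"
  obtains t where
    "\<And>\<beta>. \<beta> \<in> B \<Longrightarrow> t \<beta> \<in> obj F \<beta>"
    "\<And>\<beta> \<gamma>. \<beta> \<in> B \<Longrightarrow> \<gamma> \<in> B \<Longrightarrow> \<gamma> \<subseteq> \<beta> \<Longrightarrow> res F \<beta> \<gamma> (t \<beta>) = t \<gamma>"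
    "\<And>\<alpha>. \<alpha> \<in> C \<Longrightarrow> t \<alpha> = s \<alpha>"
proof -
  from F obtain h where ne: "\<And>j. j \<in> J \<Longrightarrow> E j \<noteq> {}"
    and "copresheaf_isomorphism free_scale scale B (restricted_free E) F h"
    unfolding restricted_free_copresheaf_def by blast
  then interpret h: copresheaf_isomorphism free_scale scale B "restricted_free E" F h by simp
  let ?R = "restricted_free E :: ('j, ('j \<Rightarrow> 'b) \<Rightarrow>\<^sub>0 'a) functor_data"
  define g where "g \<beta> = inv_into (obj ?R \<beta>) (h \<beta>)" for \<beta>
  have gh: "g \<beta> (h \<beta> v) = v" if "\<beta> \<in> B" "v \<in> obj ?R \<beta>" for \<beta> v
    using that h.bij[OF that(1)] unfolding g_def by (meson bij_betw_def inv_into_f_f)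
  have hg: "h \<beta> (g \<beta> v) = v" and g: "g \<beta> v \<in> obj ?R \<beta>" if "\<beta> \<in> B" "v \<in> obj F \<beta>" for \<beta> v
    using that h.bij[OF that(1)] unfolding g_def bij_betw_def
    by (metis f_inv_into_f, metis inv_into_into)
  obtain t where t: "\<And>\<beta>. finite \<beta> \<Longrightarrow> \<beta> \<subseteq> J \<Longrightarrow> t \<beta> \<in> obj ?R \<beta>"
    "\<And>\<beta> \<gamma>. finite \<beta> \<Longrightarrow> \<gamma> \<subseteq> \<beta> \<Longrightarrow> res ?R \<beta> \<gamma> (t \<beta>) = t \<gamma>"
    "\<And>\<alpha>. \<alpha> \<in> C \<Longrightarrow> t \<alpha> = g \<alpha> (s \<alpha>)"
  proof (rule restricted_free_family_extends[where J = J and C = C and s = "\<lambda>\<alpha>. g \<alpha> (s \<alpha>)" and E = E])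
    show "hypergraph C J" using hyp CB by (auto simp: hypergraph_def)
    show "g \<alpha> (s \<alpha>) \<in> obj ?R \<alpha>" if "\<alpha> \<in> C" for \<alpha> using that CB obj g by blast
    show "res ?R \<alpha> \<beta> (g \<alpha> (s \<alpha>)) = g \<beta> (s \<beta>)" if ab: "\<alpha> \<in> C" "\<beta> \<in> C" "\<beta> \<subseteq> \<alpha>" for \<alpha> \<beta>
    proof -
      have B: "\<alpha> \<in> B" "\<beta> \<in> B" using ab CB by auto
      have go: "g \<alpha> (s \<alpha>) \<in> obj ?R \<alpha>" using g[OF B(1) obj[OF ab(1)]] .
      have "h \<beta> (res ?R \<alpha> \<beta> (g \<alpha> (s \<alpha>))) = s \<beta>"
        using h.natural[OF B ab(3) go] hg[OF B(1) obj[OF ab(1)]] compat[OF ab] by simp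
      moreover have "res ?R \<alpha> \<beta> (g \<alpha> (s \<alpha>)) \<in> obj ?R \<beta>"
        using h.source.linear_res[OF B ab(3)] go unfolding linear_between_def by blast
      ultimately show ?thesis using gh[OF B(2)] by metis
    qed
  qed (use ne wip in auto)
  have fin: "finite \<beta>" "\<beta> \<subseteq> J" if "\<beta> \<in> B" for \<beta> using that hyp by (auto simp: hypergraph_def)
  show ?thesis
  proof
    show "h \<beta> (t \<beta>) \<in> obj F \<beta>" if "\<beta> \<in> B" for \<beta>
      using h.linear[OF that] t(1)[OF fin[OF that]] unfolding linear_between_def by blast
    show "res F \<beta> \<gamma> (h \<beta> (t \<beta>)) = h \<gamma> (t \<gamma>)" if "\<beta> \<in> B" "\<gamma> \<in> B" "\<gamma> \<subseteq> \<beta>" for \<beta> \<gamma>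
      using h.natural[OF that t(1)[OF fin[OF that(1)]]] t(2)[OF fin(1) that(3)] that by metis
    show "h \<alpha> (t \<alpha>) = s \<alpha>" if "\<alpha> \<in> C" for \<alpha>
      using that CB t(3) hg obj by auto
  qed
qed

section \<open>Inverse and direct images as copresheaves\<close>

lemma copresheaf_inverse_image:
  assumes "copresheaf scale B F" and f: "f \<in> A \<rightarrow> B"
    and mono: "\<And>\<alpha> \<beta>. \<alpha> \<in> A \<Longrightarrow> \<beta> \<in> A \<Longrightarrow> \<beta> \<subseteq> \<alpha> \<Longrightarrow> f \<beta> \<subseteq> f \<alpha>"
  shows "copresheaf scale A (inverse_image f F)"
proof -
  interpret copresheaf scale B F by fact
  have fB: "f \<alpha> \<in> B" if "\<alpha> \<in> A" for \<alpha> using f that by blast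
  show ?thesis
  proof unfold_locales
    fix \<alpha> \<beta> assume "\<alpha> \<in> A" "\<beta> \<in> A" "\<beta> \<subseteq> \<alpha>"
    then show "linear_between scale scale (obj (inverse_image f F) \<alpha>) (obj (inverse_image f F) \<beta>)
        (res (inverse_image f F) \<alpha> \<beta>)"
      using linear_res[OF fB fB mono] by (simp add: inverse_image_def)
  next
    fix \<alpha> \<beta> \<gamma> v
    assume "\<alpha> \<in> A" "\<beta> \<in> A" "\<gamma> \<in> A" "\<beta> \<subseteq> \<alpha>" "\<gamma> \<subseteq> \<beta>" "v \<in> obj (inverse_image f F) \<alpha>"
    then show "res (inverse_image f F) \<beta> \<gamma> (res (inverse_image f F) \<alpha> \<beta> v) =
        res (inverse_image f F) \<alpha> \<gamma> v"
      using res_comp[OF fB fB fB mono mono] by (simp add: inverse_image_def)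
  qed (simp_all add: inverse_image_def subspace_obj res_id fB)
qed

lemma (in copresheaf) subspace_sections:
  assumes "W \<subseteq> A"
  shows "module.subspace (fun_scale scale) (sections F W)"
proof -
  interpret fs: vector_space "fun_scale scale :: 'k \<Rightarrow> ('i set \<Rightarrow> 'v) \<Rightarrow> _"
    by (rule vector_space_fun_scale) unfold_locales
  have lin: "linear_between scale scale (obj F \<alpha>) (obj F \<beta>) (res F \<alpha> \<beta>)"
    if "\<alpha> \<in> W" "\<beta> \<in> W" "\<beta> \<subseteq> \<alpha>" for \<alpha> \<beta> using linear_res that assms by blast
  have sub: "subspace (obj F \<alpha>)" if "\<alpha> \<in> W" for \<alpha> using that assms subspace_obj by blast
  show ?thesis
  proof (rule fs.subspaceI)
    \<comment> \<open>\<open>linear_between\<close> does not state this; it follows from homogeneity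
      with the scalar 0.\<close>
    have "res F \<alpha> \<beta> 0 = 0" if "\<alpha> \<in> W" "\<beta> \<in> W" "\<beta> \<subseteq> \<alpha>" for \<alpha> \<beta>
      using lin[OF that] subspace_0[OF sub[OF that(1)]] unfolding linear_between_def
      by (metis scale_zero_left)
    then show "0 \<in> sections F W" by (auto simp: sections_def subspace_0 sub)
  next
    fix s t assume "s \<in> sections F W" "t \<in> sections F W"
    then show "s + t \<in> sections F W"
      using lin unfolding sections_def linear_between_def
      by (auto simp: subspace_add sub)
  next
    fix c s assume "s \<in> sections F W"
    then show "fun_scale scale c s \<in> sections F W"
      using lin unfolding sections_def linear_between_def fun_scale_def
      by (auto simp: subspace_scale sub)
  qed
qed

lemma restrict_section_sections:
  "s \<in> sections F W \<Longrightarrow> W' \<subseteq> W \<Longrightarrow> restrict_section W' s \<in> sections F W'"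
  by (auto simp: sections_def restrict_section_def subset_iff)

lemma copresheaf_direct_image:
  assumes "copresheaf scale A F"
  shows "copresheaf (fun_scale scale) B (direct_image A B f F)"
proof -
  interpret copresheaf scale A F by fact
  have mono: "preimage_open A f (basic_open B \<gamma>) \<subseteq> preimage_open A f (basic_open B \<beta>)"
    if "\<gamma> \<subseteq> \<beta>" for \<beta> \<gamma> using that by (auto simp: preimage_open_def basic_open_def)
  have sub: "preimage_open A f W \<subseteq> A" for W by (auto simp: preimage_open_def)
  show ?thesis
  proof (intro copresheaf.intro copresheaf_axioms.intro)
    show "vector_space (fun_scale scale)" by (rule vector_space_fun_scale) unfold_locales
    fix \<alpha> \<beta> \<gamma> :: "'d set" and v
    show "module.subspace (fun_scale scale) (obj (direct_image A B f F) \<alpha>)"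
      by (simp add: direct_image_def subspace_sections sub)
    show "linear_between (fun_scale scale) (fun_scale scale) (obj (direct_image A B f F) \<alpha>)
        (obj (direct_image A B f F) \<beta>) (res (direct_image A B f F) \<alpha> \<beta>)" if "\<beta> \<subseteq> \<alpha>"
      using restrict_section_sections[OF _ mono[OF that]]
      by (auto simp: linear_between_def direct_image_def restrict_section_def fun_scale_def fun_eq_iff)
    \<comment> \<open>Restricting to the same open set is the identity because sections already
      vanish outside it.\<close>
    show "res (direct_image A B f F) \<alpha> \<alpha> v = v" if "v \<in> obj (direct_image A B f F) \<alpha>"
      using that by (auto simp: direct_image_def restrict_section_def sections_def fun_eq_iff)
    show "res (direct_image A B f F) \<beta> \<gamma> (res (direct_image A B f F) \<alpha> \<beta> v) =
        res (direct_image A B f F) \<alpha> \<gamma> v" if "\<gamma> \<subseteq> \<beta>"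
      using mono[OF that] by (auto simp: direct_image_def restrict_section_def fun_eq_iff)
  qed
qed

section \<open>Simplicial inclusions and images of hypergraphs\<close>

text \<open>On \<open>A\<close> the functor is the image map of the injective
  \<open>f\<^sub>I\<close>, so it not only preserves but also reflects inclusions and commutes with
  intersections.\<close>

lemma simplicial_inclusionD:
  assumes "simplicial_inclusion A I B J f f\<^sub>I" and "hypergraph A I"
  shows "\<And>\<alpha>. \<alpha> \<in> A \<Longrightarrow> f \<alpha> \<in> B"
    and "\<And>\<alpha>. \<alpha> \<in> A \<Longrightarrow> f \<alpha> = f\<^sub>I ` \<alpha>"
    and "\<And>\<alpha> \<beta>. \<alpha> \<in> A \<Longrightarrow> \<beta> \<in> A \<Longrightarrow> f \<beta> \<subseteq> f \<alpha> \<longleftrightarrow> \<beta> \<subseteq> \<alpha>"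
    and "\<And>\<alpha> \<beta>. \<alpha> \<in> A \<Longrightarrow> \<beta> \<in> A \<Longrightarrow> \<alpha> \<inter> \<beta> \<in> A \<Longrightarrow> f (\<alpha> \<inter> \<beta>) = f \<alpha> \<inter> f \<beta>"
    and "inj_on f A" and "inj_on f\<^sub>I I" and "f\<^sub>I \<in> I \<rightarrow> J"
proof -
  note defs = simplicial_inclusion_def simplicial_morphism_def strict_morphism_def hypergraph_def
  show "\<And>\<alpha>. \<alpha> \<in> A \<Longrightarrow> f \<alpha> \<in> B" and img: "\<And>\<alpha>. \<alpha> \<in> A \<Longrightarrow> f \<alpha> = f\<^sub>I ` \<alpha>"
    and "inj_on f A" and inj: "inj_on f\<^sub>I I" and "f\<^sub>I \<in> I \<rightarrow> J"
    using assms unfolding defs by auto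
  have sub: "\<alpha> \<subseteq> I" if "\<alpha> \<in> A" for \<alpha> using that assms unfolding defs by auto
  show "f \<beta> \<subseteq> f \<alpha> \<longleftrightarrow> \<beta> \<subseteq> \<alpha>" if "\<alpha> \<in> A" "\<beta> \<in> A" for \<alpha> \<beta>
    using sub[OF that(1)] sub[OF that(2)] that inj unfolding inj_on_def by (simp add: img) blast
  show "f (\<alpha> \<inter> \<beta>) = f \<alpha> \<inter> f \<beta>" if "\<alpha> \<in> A" "\<beta> \<in> A" "\<alpha> \<inter> \<beta> \<in> A" for \<alpha> \<beta>
    using that inj_on_image_Int[OF inj] sub by (simp add: img)
qed

text \<open>Injectivity of \<open>f\<^sub>I\<close> lifts a common point of two images to a common
  point of their sources, so these meet in a member of \<open>A\<close>, which lies in the downward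
  closed \<open>W\<close>. The lemma serves both for \<open>A\<close> itself and for the preimage of
  a basic open set.\<close>

lemma weak_intersection_property_image:
  assumes wip: "weak_intersection_property A"
    and inc: "simplicial_inclusion A I B J f f\<^sub>I" and hyp: "hypergraph A I"
    and W: "W \<subseteq> A" "\<And>\<alpha> \<beta>. \<alpha> \<in> W \<Longrightarrow> \<beta> \<in> A \<Longrightarrow> \<beta> \<subseteq> \<alpha> \<Longrightarrow> \<beta> \<in> W"
  shows "weak_intersection_property (f ` W)"
  unfolding weak_intersection_property_def
proof (intro ballI impI)
  note D = simplicial_inclusionD[OF inc hyp]
  fix \<gamma> \<gamma>' assume "\<gamma> \<in> f ` W" "\<gamma>' \<in> f ` W" and ne: "\<gamma> \<inter> \<gamma>' \<noteq> {}"
  then obtain \<alpha> \<alpha>' where \<alpha>: "\<gamma> = f \<alpha>" "\<gamma>' = f \<alpha>'" "\<alpha> \<in> W" "\<alpha>' \<in> W" by blast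
  then have A: "\<alpha> \<in> A" "\<alpha>' \<in> A" using W(1) by auto
  have "f\<^sub>I ` (\<alpha> \<inter> \<alpha>') = f\<^sub>I ` \<alpha> \<inter> f\<^sub>I ` \<alpha>'"
    using A hyp by (intro inj_on_image_Int[OF D(6)]) (auto simp: hypergraph_def)
  then have "\<alpha> \<inter> \<alpha>' \<noteq> {}" using ne A \<alpha>(1,2) D(2) by auto
  then have "\<alpha> \<inter> \<alpha>' \<in> A" using A wip by (simp add: weak_intersection_property_def)
  then have "\<alpha> \<inter> \<alpha>' \<in> W" and "\<gamma> \<inter> \<gamma>' = f (\<alpha> \<inter> \<alpha>')" using A \<alpha> W(2) D(4) by auto
  then show "\<gamma> \<inter> \<gamma>' \<in> f ` W" by blast
qed

section \<open>Extension of sections and surjectivity of the unit map\<close>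

lemma section_inverse_image_extends:
  fixes F' :: "('j, 'v::ab_group_add) functor_data"
  assumes hypA: "hypergraph A I" and hypB: "hypergraph B J"
    and inc: "simplicial_inclusion A I B J f f\<^sub>I"
    and F': "restricted_free_copresheaf scale B J E' F'"
    and W: "W \<subseteq> A" "weak_intersection_property (f ` W)"
    and s: "s \<in> sections (inverse_image f F') W"
  obtains t where "t \<in> H0 B F'" and "\<And>\<alpha>. \<alpha> \<in> W \<Longrightarrow> t (f \<alpha>) = s \<alpha>"
proof -
  note D = simplicial_inclusionD[OF inc hypA]
  define s' where "s' \<gamma> = s (inv_into A f \<gamma>)" for \<gamma>
  have s': "s' (f \<alpha>) = s \<alpha>" if "\<alpha> \<in> W" for \<alpha>
    using that W(1) D(5) unfolding s'_def by (simp add: subset_iff)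
  obtain t where t: "\<And>\<beta>. \<beta> \<in> B \<Longrightarrow> t \<beta> \<in> obj F' \<beta>"
    "\<And>\<beta> \<gamma>. \<beta> \<in> B \<Longrightarrow> \<gamma> \<in> B \<Longrightarrow> \<gamma> \<subseteq> \<beta> \<Longrightarrow> res F' \<beta> \<gamma> (t \<beta>) = t \<gamma>"
    "\<And>\<alpha>. \<alpha> \<in> f ` W \<Longrightarrow> t \<alpha> = s' \<alpha>"
  proof (rule restricted_free_copresheaf_family_extends[OF F' hypB _ W(2), of s'])
    show "f ` W \<subseteq> B" using W(1) D(1) by blast
    show "s' \<alpha> \<in> obj F' \<alpha>" if "\<alpha> \<in> f ` W" for \<alpha>
      using that s s' by (auto simp: sections_def inverse_image_def)
    show "res F' \<alpha> \<beta> (s' \<alpha>) = s' \<beta>" if ab: "\<alpha> \<in> f ` W" "\<beta> \<in> f ` W" "\<beta> \<subseteq> \<alpha>" for \<alpha> \<beta>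
    proof -
      obtain \<alpha>0 \<beta>0 where *: "\<alpha> = f \<alpha>0" "\<beta> = f \<beta>0" "\<alpha>0 \<in> W" "\<beta>0 \<in> W" using ab by blast
      then have "\<beta>0 \<subseteq> \<alpha>0" using ab D(3) W(1) by blast
      then show ?thesis using * s s' by (auto simp: sections_def inverse_image_def)
    qed
  qed (rule that)
  show ?thesis
  proof
    \<comment> \<open>The extension is uncontrolled outside \<open>B\<close>, while a global section
      has to vanish there.\<close>
    show "restrict_section B t \<in> H0 B F'"
      using t by (auto simp: H0_def sections_def restrict_section_def)
    show "restrict_section B t (f \<alpha>) = s \<alpha>" if "\<alpha> \<in> W" for \<alpha>
      using that W(1) t(3)[of "f \<alpha>"] s' D(1) by (auto simp: restrict_section_def)
  qed
qed

text \<open>A section over the preimage of the basic open set at \<beta> extends to a global section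
  \<open>t\<close>. The unit map sends \<open>t \<beta>\<close> back to the given section, because
  restricting \<open>t \<beta>\<close> to \<open>f \<alpha>\<close> yields
  \<open>t (f \<alpha>)\<close>.\<close>

lemma copresheaf_surjection_unit_map:
  fixes F' :: "('j, 'v::ab_group_add) functor_data"
  assumes hypA: "hypergraph A I" and hypB: "hypergraph B J"
    and wip: "weak_intersection_property A"
    and inc: "simplicial_inclusion A I B J f f\<^sub>I"
    and F': "restricted_free_copresheaf scale B J E' F'"
    and cop: "copresheaf scale B F'"
  shows "copresheaf_surjection scale (fun_scale scale) B F'
      (direct_image A B f (inverse_image f F')) (unit_map A B f F')"
proof -
  note D = simplicial_inclusionD[OF inc hypA]
  interpret F': copresheaf scale B F' by fact
  interpret F: copresheaf scale A "inverse_image f F'"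
    by (rule copresheaf_inverse_image[OF cop]) (auto simp: D(1,3))
  interpret G: copresheaf "fun_scale scale" B "direct_image A B f (inverse_image f F')"
    by (rule copresheaf_direct_image) unfold_locales
  have unit: "unit_map A B f F' \<beta> v \<alpha> = (if \<alpha> \<in> A \<and> f \<alpha> \<subseteq> \<beta> then res F' \<beta> (f \<alpha>) v else 0)"
    for \<beta> v \<alpha>
    using D(1) by (auto simp: unit_map_def pullback_section_def restrict_section_def
        preimage_open_def basic_open_def)
  have W: "\<alpha> \<in> preimage_open A f (basic_open B \<beta>) \<longleftrightarrow> \<alpha> \<in> A \<and> f \<alpha> \<subseteq> \<beta>" for \<alpha> \<beta>
    using D(1) by (auto simp: preimage_open_def basic_open_def)
  have lin: "h \<in> V \<rightarrow> U" "x \<in> V \<Longrightarrow> y \<in> V \<Longrightarrow> h (x + y) = h x + h y"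
    "x \<in> V \<Longrightarrow> h (scale c x) = scale c (h x)"
    if "linear_between scale scale V U h" for h V U x y c
    using that by (auto simp: linear_between_def)
  have unit_obj: "unit_map A B f F' \<beta> v \<in> obj (direct_image A B f (inverse_image f F')) \<beta>"
    if \<beta>: "\<beta> \<in> B" and v: "v \<in> obj F' \<beta>" for \<beta> v
    using funcset_mem[OF lin(1)[OF F'.linear_res[OF \<beta>]] v] D(1,3)
      F'.res_comp[OF \<beta> _ _ _ _ v]
    by (auto simp: direct_image_def sections_def W unit inverse_image_def)
  show ?thesis
  proof unfold_locales
    fix \<beta> assume \<beta>: "\<beta> \<in> B"
    show "linear_between scale (fun_scale scale) (obj F' \<beta>)
        (obj (direct_image A B f (inverse_image f F')) \<beta>) (unit_map A B f F' \<beta>)"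
      unfolding linear_between_def
      using unit_obj[OF \<beta>] lin(2,3)[OF F'.linear_res[OF \<beta>]] D(1)
      by (auto simp: fun_eq_iff unit fun_scale_def)
    show "unit_map A B f F' \<beta> ` obj F' \<beta> = obj (direct_image A B f (inverse_image f F')) \<beta>"
    proof
      show "unit_map A B f F' \<beta> ` obj F' \<beta> \<subseteq> obj (direct_image A B f (inverse_image f F')) \<beta>"
        using unit_obj[OF \<beta>] by blast
      show "obj (direct_image A B f (inverse_image f F')) \<beta> \<subseteq> unit_map A B f F' \<beta> ` obj F' \<beta>"
      proof
        fix s assume "s \<in> obj (direct_image A B f (inverse_image f F')) \<beta>"
        then have s: "s \<in> sections (inverse_image f F') (preimage_open A f (basic_open B \<beta>))"
          by (simp add: direct_image_def)
        have "weak_intersection_property (f ` preimage_open A f (basic_open B \<beta>))"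
        proof (rule weak_intersection_property_image[OF wip inc hypA])
          show "\<alpha>' \<in> preimage_open A f (basic_open B \<beta>)"
            if "\<alpha> \<in> preimage_open A f (basic_open B \<beta>)" "\<alpha>' \<in> A" "\<alpha>' \<subseteq> \<alpha>" for \<alpha> \<alpha>'
            using that D(3)[of \<alpha> \<alpha>'] by (auto simp: W)
        qed (simp add: preimage_open_def)
        moreover have "preimage_open A f (basic_open B \<beta>) \<subseteq> A" using W by blast
        ultimately obtain t where t: "t \<in> H0 B F'"
          and ts: "\<And>\<alpha>. \<alpha> \<in> preimage_open A f (basic_open B \<beta>) \<Longrightarrow> t (f \<alpha>) = s \<alpha>"
          using section_inverse_image_extends[OF hypA hypB inc F' _ _ s] by blast
        have "unit_map A B f F' \<beta> (t \<beta>) = s"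
          using t ts s D(1) \<beta> by (auto simp: fun_eq_iff unit W H0_def sections_def)
        moreover have "t \<beta> \<in> obj F' \<beta>" using t \<beta> by (auto simp: H0_def sections_def)
        ultimately show "s \<in> unit_map A B f F' \<beta> ` obj F' \<beta>" by blast
      qed
    qed
  next
    fix \<beta> \<gamma> v assume \<beta>: "\<beta> \<in> B" "\<gamma> \<in> B" "\<gamma> \<subseteq> \<beta>" "v \<in> obj F' \<beta>"
    have "res F' \<gamma> (f \<alpha>) (res F' \<beta> \<gamma> v) = res F' \<beta> (f \<alpha>) v" if "\<alpha> \<in> A" "f \<alpha> \<subseteq> \<gamma>" for \<alpha>
      using F'.res_comp[OF \<beta>(1,2) D(1) \<beta>(3) _ \<beta>(4)] that by blast
    then show "unit_map A B f F' \<gamma> (res F' \<beta> \<gamma> v) =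
        res (direct_image A B f (inverse_image f F')) \<beta> \<gamma> (unit_map A B f F' \<beta> v)"
      using \<beta>(3) by (auto simp: fun_eq_iff unit direct_image_def restrict_section_def W)
  qed
qed

section \<open>The inverse image is restricted free\<close>

text \<open>Because \<open>f\<^sub>I\<close> maps \<alpha> bijectively onto
  \<open>f \<alpha>\<close>, the product of the sets \<open>E'\<close> over
  \<open>f \<alpha>\<close> is the product of \<open>E' \<circ> f\<^sub>I\<close> over \<alpha>
  after reindexing. The isomorphism is this reindexing followed by \<open>h\<close>.\<close>

lemma restricted_free_copresheaf_inverse_image:
  fixes F' :: "('j, 'v::ab_group_add) functor_data" and f :: "'i set \<Rightarrow> 'j set"
  assumes hypA: "hypergraph A I"
    and inc: "simplicial_inclusion A I B J f f\<^sub>I"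
    and F': "restricted_free_copresheaf scale B J E' F'"
  shows "restricted_free_copresheaf scale A I (E' \<circ> f\<^sub>I) (inverse_image f F')"
proof -
  note D = simplicial_inclusionD[OF inc hypA]
  from F' obtain h where ne: "\<And>j. j \<in> J \<Longrightarrow> E' j \<noteq> {}"
    and "copresheaf_isomorphism free_scale scale B (restricted_free E') F' h"
    unfolding restricted_free_copresheaf_def by blast
  then interpret h: copresheaf_isomorphism free_scale scale B "restricted_free E'" F' h by simp
  interpret F: copresheaf scale A "inverse_image f F'"
    by (rule copresheaf_inverse_image[OF h.target.copresheaf_axioms]) (auto simp: D(1,3))
  interpret R: copresheaf free_scale A "restricted_free (E' \<circ> f\<^sub>I)"
    by (rule copresheaf_restricted_free)
  let ?R = "restricted_free (E' \<circ> f\<^sub>I) :: ('i, ('i \<Rightarrow> 'b) \<Rightarrow>\<^sub>0 'a) functor_data"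
  let ?R' = "restricted_free E' :: ('j, ('j \<Rightarrow> 'b) \<Rightarrow>\<^sub>0 'a) functor_data"
  define g where "g = inv_into I f\<^sub>I"
  \<comment> \<open>Reindexing along the inverse of \<open>f\<^sub>I\<close> and along
    \<open>f\<^sub>I\<close>; the restricted lambdas keep the results undefined outside
    \<open>f \<alpha>\<close> and \<alpha>.\<close>
  define p where "p \<alpha> x = (\<lambda>j\<in>f \<alpha>. x (g j))" for \<alpha> and x :: "'i \<Rightarrow> 'b"
  define q where "q \<alpha> x = (\<lambda>i\<in>\<alpha>. x (f\<^sub>I i))" for \<alpha> and x :: "'j \<Rightarrow> 'b"
  have gf: "g (f\<^sub>I i) = i" if "\<alpha> \<in> A" "i \<in> \<alpha>" for \<alpha> i
    using that hypA D(6) unfolding g_def hypergraph_def by (blast intro: inv_into_f_f)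
  have p_mem: "p \<alpha> x \<in> PiE (f \<alpha>) E'" if "\<alpha> \<in> A" "x \<in> PiE \<alpha> (E' \<circ> f\<^sub>I)" for \<alpha> x
    using that gf[OF that(1)] by (auto simp: p_def D(2) PiE_def Pi_def)
  have q_mem: "q \<alpha> x \<in> PiE \<alpha> (E' \<circ> f\<^sub>I)" if "\<alpha> \<in> A" "x \<in> PiE (f \<alpha>) E'" for \<alpha> x
    using that by (auto simp: q_def D(2) PiE_def Pi_def)
  have qp: "q \<alpha> (p \<alpha> x) = x" if "\<alpha> \<in> A" "x \<in> PiE \<alpha> (E' \<circ> f\<^sub>I)" for \<alpha> x
    using that gf[OF that(1)] by (auto simp: p_def q_def D(2) PiE_def extensional_def fun_eq_iff)
  have pq: "p \<alpha> (q \<alpha> x) = x" if "\<alpha> \<in> A" "x \<in> PiE (f \<alpha>) E'" for \<alpha> x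
    using that gf[OF that(1)] by (auto simp: p_def q_def D(2) PiE_def extensional_def fun_eq_iff)
  have bij: "bij_betw (free_map (p \<alpha>)) (obj ?R \<alpha>) (obj ?R' (f \<alpha>))" if \<alpha>: "\<alpha> \<in> A" for \<alpha>
  proof (rule bij_betwI[where g = "free_map (q \<alpha>)"])
    show "free_map (p \<alpha>) \<in> obj ?R \<alpha> \<rightarrow> obj ?R' (f \<alpha>)"
      unfolding Pi_iff Ball_def obj_restricted_free coord_sum_free_map
      using keys_free_map_subset p_mem[OF \<alpha>] by metis
    show "free_map (q \<alpha>) \<in> obj ?R' (f \<alpha>) \<rightarrow> obj ?R \<alpha>"
      unfolding Pi_iff Ball_def obj_restricted_free coord_sum_free_map
      using keys_free_map_subset q_mem[OF \<alpha>] by metis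
    show "free_map (q \<alpha>) (free_map (p \<alpha>) v) = v" if "v \<in> obj ?R \<alpha>" for v
    proof -
      have "free_map (\<lambda>x. q \<alpha> (p \<alpha> x)) v = free_map (\<lambda>x. x) v"
        using that qp[OF \<alpha>] by (intro free_map_cong) auto
      then show ?thesis by (simp add: free_map_comp free_map_ident)
    qed
    show "free_map (p \<alpha>) (free_map (q \<alpha>) v) = v" if "v \<in> obj ?R' (f \<alpha>)" for v
    proof -
      have "free_map (\<lambda>x. p \<alpha> (q \<alpha> x)) v = free_map (\<lambda>x. x) v"
        using that pq[OF \<alpha>] by (intro free_map_cong) auto
      then show ?thesis by (simp add: free_map_comp free_map_ident)
    qed
  qed
  have p_obj: "free_map (p \<alpha>) v \<in> obj ?R' (f \<alpha>)" if "\<alpha> \<in> A" "v \<in> obj ?R \<alpha>" for \<alpha> v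
    using bij_betwE[OF bij[OF that(1)]] that(2) by blast
  have "copresheaf_isomorphism free_scale scale A ?R (inverse_image f F')
      (\<lambda>\<alpha> v. h (f \<alpha>) (free_map (p \<alpha>) v))"
  proof unfold_locales
    fix \<alpha> assume \<alpha>: "\<alpha> \<in> A"
    show "linear_between free_scale scale (obj ?R \<alpha>) (obj (inverse_image f F') \<alpha>)
        (\<lambda>v. h (f \<alpha>) (free_map (p \<alpha>) v))"
      using h.linear[OF D(1)[OF \<alpha>]] p_obj[OF \<alpha>] unfolding linear_between_def
      by (simp add: inverse_image_def free_map_add free_map_scale Pi_iff del: obj_restricted_free)
    show "bij_betw (\<lambda>v. h (f \<alpha>) (free_map (p \<alpha>) v)) (obj ?R \<alpha>) (obj (inverse_image f F') \<alpha>)"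
      using bij_betw_trans[OF bij[OF \<alpha>] h.bij[OF D(1)[OF \<alpha>]]]
      by (simp add: comp_def inverse_image_def)
  next
    fix \<alpha> \<beta> v assume *: "\<alpha> \<in> A" "\<beta> \<in> A" "\<beta> \<subseteq> \<alpha>" and v: "v \<in> obj ?R \<alpha>"
    \<comment> \<open>For \<open>j\<close> in \<open>f \<beta>\<close> the index \<open>g j\<close>
      lies in \<beta>, so restricting before or after reindexing gives the same coordinate.\<close>
    have "free_map (p \<beta>) (res ?R \<alpha> \<beta> v) = res ?R' (f \<alpha>) (f \<beta>) (free_map (p \<alpha>) v)"
      unfolding res_restricted_free free_map_comp
      by (rule free_map_cong) (use * gf[OF *(2)] in \<open>auto simp: p_def D(2) fun_eq_iff restrict_def\<close>)
    then show "h (f \<beta>) (free_map (p \<beta>) (res ?R \<alpha> \<beta> v)) =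
        res (inverse_image f F') \<alpha> \<beta> (h (f \<alpha>) (free_map (p \<alpha>) v))"
      using h.natural[OF D(1)[OF *(1)] D(1)[OF *(2)] _ p_obj[OF *(1) v]] * D(3)
      by (simp add: inverse_image_def)
  qed
  then show ?thesis using ne D(7) unfolding restricted_free_copresheaf_def by auto
qed

section \<open>Global sections and the combined statement\<close>

theorem theorem5p15:
  fixes A :: "'i set set" and I :: "'i set"
    and B :: "'j set set" and J :: "'j set"
    and \<iota> :: "'i set \<Rightarrow> 'j set" and \<iota>\<^sub>I :: "'i \<Rightarrow> 'j"
    and scale :: "'k::field \<Rightarrow> 'v::ab_group_add \<Rightarrow> 'v"
    and E' :: "'j \<Rightarrow> 'e set"
    and F' :: "('j, 'v) functor_data"
  assumes "hypergraph A I" and "hypergraph B J"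
    and "weak_intersection_property A" and "weak_intersection_property B"
    and "simplicial_inclusion A I B J \<iota> \<iota>\<^sub>I"
    and "restricted_free_copresheaf scale B J E' F'"
  shows "(\<exists>E :: 'i \<Rightarrow> 'e set. restricted_free_copresheaf scale A I E (inverse_image \<iota> F')) \<and>
    copresheaf_surjection scale (fun_scale scale) B F'
      (direct_image A B \<iota> (inverse_image \<iota> F')) (unit_map A B \<iota> F') \<and>
    linear_between (fun_scale scale) (fun_scale scale)
      (H0 B F') (H0 A (inverse_image \<iota> F')) (H0_map A B \<iota>) \<and>
    H0_map A B \<iota> ` H0 B F' = H0 A (inverse_image \<iota> F')"
proof (intro conjI)
  note D = simplicial_inclusionD[OF assms(5,1)]
  show "\<exists>E :: 'i \<Rightarrow> 'e set. restricted_free_copresheaf scale A I E (inverse_image \<iota> F')"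
    using restricted_free_copresheaf_inverse_image[OF assms(1,5,6)] by blast
  have cop: "copresheaf scale B F'"
    using assms(6) unfolding restricted_free_copresheaf_def
      copresheaf_isomorphism_def copresheaf_morphism_def by blast
  show "copresheaf_surjection scale (fun_scale scale) B F'
      (direct_image A B \<iota> (inverse_image \<iota> F')) (unit_map A B \<iota> F')"
    by (rule copresheaf_surjection_unit_map[OF assms(1,2,3,5,6) cop])
  have H0_map: "H0_map A B \<iota> s \<alpha> = (if \<alpha> \<in> A then s (\<iota> \<alpha>) else 0)" for s :: "'j set \<Rightarrow> 'v" and \<alpha>
    using D(1) by (auto simp: H0_map_def pullback_section_def restrict_section_def preimage_open_def)
  have mem: "H0_map A B \<iota> s \<in> H0 A (inverse_image \<iota> F')" if "s \<in> H0 B F'" for s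
    using that D(1,3) by (auto simp: H0_def sections_def H0_map inverse_image_def)
  interpret copresheaf scale B F' by (rule cop)
  show "linear_between (fun_scale scale) (fun_scale scale)
      (H0 B F') (H0 A (inverse_image \<iota> F')) (H0_map A B \<iota>)"
    using mem by (auto simp: linear_between_def fun_eq_iff H0_map fun_scale_def)
  show "H0_map A B \<iota> ` H0 B F' = H0 A (inverse_image \<iota> F')"
  proof
    show "H0_map A B \<iota> ` H0 B F' \<subseteq> H0 A (inverse_image \<iota> F')" using mem by blast
    show "H0 A (inverse_image \<iota> F') \<subseteq> H0_map A B \<iota> ` H0 B F'"
    proof
      fix s assume s: "s \<in> H0 A (inverse_image \<iota> F')"
      \<comment> \<open>Global sections are the case in which the open set is all of
        \<open>A\<close>.\<close>
      have "weak_intersection_property (\<iota> ` A)"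
        by (rule weak_intersection_property_image[OF assms(3,5,1)]) auto
      then obtain t where t: "t \<in> H0 B F'" and ts: "\<And>\<alpha>. \<alpha> \<in> A \<Longrightarrow> t (\<iota> \<alpha>) = s \<alpha>"
        using section_inverse_image_extends[OF assms(1,2,5,6) order_refl _ s[unfolded H0_def]] by blast
      \<comment> \<open>Off \<open>A\<close> both sides are 0, the right one because sections are
        extended by zero.\<close>
      have "H0_map A B \<iota> t = s"
        using s ts by (auto simp: fun_eq_iff H0_map H0_def sections_def)
      then show "s \<in> H0_map A B \<iota> ` H0 B F'" using t by blast
    qed
  qed
qed

end
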